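(* Let $a,b,c$ be nonzero real numbers, let $w_0,w_1$ be arbitrary real initial values, let $\{w_n\}$ be the associated generalized bi-periodic Horadam sequence and $\{u_n\}$ the generalized bi-periodic Fibonacci sequence. Then for any positive integers $n$ and $p$, $$w_{n+p}=\left(\frac ba\right)^{\zeta(n+1)\zeta(p)}u_n w_{p+1}+c\left(\frac ba\right)^{\zeta(n)\zeta(p+1)}u_{n-1}w_p.$$
   Context: For nonzero real numbers $a,b,c$ and real initial values $w_0,w_1$, the generalized bi-periodic Horadam sequence $\{w_n\}$ is defined by $w_n=\chi(n)w_{n-1}+c\,w_{n-2}$ for $n\ge 2$, where $\chi(n)=a$ if $n$ is even and $\chi(n)=b$ if $n$ is odd. The generalized bi-periodic Fibonacci sequence $\{u_n\}$ satisfies the same recurrence (same $a,b,c$) with $u_0=0$, $u_1=1$. The parity function is $\zeta(n)=0$ if $n$ is even and $\zeta(n)=1$ if $n$ is odd. *)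

theory Defs
  imports Complex_Main
begin

definition bp_coeff :: "real \<Rightarrow> real \<Rightarrow> nat \<Rightarrow> real" where
  "bp_coeff a b n = (if even n then a else b)"

text \<open>The last two arguments are the initial values \<open>w\<^sub>0\<close> and \<open>w\<^sub>1\<close>.\<close>

fun bp_horadam :: "real \<Rightarrow> real \<Rightarrow> real \<Rightarrow> real \<Rightarrow> real \<Rightarrow> nat \<Rightarrow> real" where
  "bp_horadam a b c w0 w1 0 = w0"
| "bp_horadam a b c w0 w1 (Suc 0) = w1"
| "bp_horadam a b c w0 w1 (Suc (Suc n)) =
     bp_coeff a b (Suc (Suc n)) * bp_horadam a b c w0 w1 (Suc n) + c * bp_horadam a b c w0 w1 n"

definition bp_fib :: "real \<Rightarrow> real \<Rightarrow> real \<Rightarrow> nat \<Rightarrow> real" where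
  "bp_fib a b c = bp_horadam a b c 0 1"

definition parity_fn :: "nat \<Rightarrow> nat" where
  "parity_fn n = (if even n then 0 else 1)"

end

theory Submission
  imports Defs
begin

text \<open>For fixed \<open>p\<close>, both sides satisfy the same second-order recurrence in
  \<open>n\<close>, so agreement at two consecutive \<open>n\<close> suffices. The coefficient for
  \<open>w (n + p)\<close> depends on the parity of \<open>n + p\<close>, those for
  \<open>u n\<close> and \<open>u (n - 1)\<close> on their own index; where the parities differ,
  \<open>a\<close> and \<open>b\<close> are swapped, and the alternating factor \<open>b / a\<close>
  undoes the swap. \<open>bp_horadam_add_Suc\<close> puts \<open>n = Suc m\<close>, avoiding
  subtraction.\<close>

lemma bp_horadam_add_Suc:
  fixes a b c w0 w1 :: real and m p :: nat
  defines "w \<equiv> bp_horadam a b c w0 w1"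
  assumes "a \<noteq> 0"
  shows "w (Suc m + p) =
    (b / a) ^ (parity_fn m * parity_fn p) * bp_fib a b c (Suc m) * w (Suc p)
    + c * (b / a) ^ (parity_fn (Suc m) * parity_fn (Suc p)) * bp_fib a b c m * w p"
proof (induction m rule: induct_nat_012)
  case 0
  show ?case by (simp add: bp_fib_def parity_fn_def)
next
  case 1
  \<comment> \<open>Here \<open>u 2 = a\<close>; for odd \<open>p\<close> the factor turns it into
    \<open>(b / a) * a = b\<close>.\<close>
  show ?case using \<open>a \<noteq> 0\<close>
    by (simp add: w_def bp_fib_def parity_fn_def bp_coeff_def)
next
  case (ge2 m)
  \<comment> \<open>The coefficient depends only on parity, so its index may drop by two.\<close>
  have "w (Suc (Suc (Suc m)) + p)
      = bp_coeff a b (Suc m + p) * w (Suc (Suc m) + p) + c * w (Suc m + p)"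
    by (simp add: w_def bp_coeff_def)
  \<comment> \<open>Writing \<open>b = r * a\<close> removes the division: in each parity class of
    \<open>m\<close> and \<open>p\<close> the claim is a polynomial identity.\<close>
  moreover define r where "r = b / a"
  moreover have "b = r * a" using \<open>a \<noteq> 0\<close> by (simp add: r_def)
  ultimately show ?case
    unfolding ge2 r_def[symmetric]
    by (cases "even m"; cases "even p")
      (simp_all add: bp_fib_def parity_fn_def bp_coeff_def algebra_simps)
qed

theorem theorem3:
  fixes a b c w0 w1 :: real and w u :: "nat \<Rightarrow> real" and n p :: nat
  assumes "a \<noteq> 0" and "b \<noteq> 0" and "c \<noteq> 0"
    and "w = bp_horadam a b c w0 w1"
    and "u = bp_fib a b c"
    and "n > 0" and "p > 0"
  shows "w (n + p) =
    (b / a) ^ (parity_fn (n + 1) * parity_fn p) * u n * w (p + 1)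
    + c * (b / a) ^ (parity_fn n * parity_fn (p + 1)) * u (n - 1) * w p"
proof -
  obtain m where "n = Suc m" using \<open>n > 0\<close> gr0_implies_Suc by blast
  moreover have "parity_fn (Suc (Suc m)) = parity_fn m"
    by (simp add: parity_fn_def)
  ultimately show ?thesis
    using bp_horadam_add_Suc[OF \<open>a \<noteq> 0\<close>, of b c w0 w1 m p] assms(4,5) by simp
qed

end
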